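(* For every integer $t\ge 3$, there exists a pair of non $\epsilon$-cospectral $\epsilon$-equienergetic graphs on $12t$ vertices.
   Context: All graphs are finite, simple, undirected and connected. For a connected graph $G$ with distance function $d$, the eccentricity of a vertex $v$ is $e(v)=\max\{d(v,u):u\in V(G)\}$. The eccentricity matrix $\epsilon(G)$ is the symmetric matrix indexed by $V(G)$ with $(u,v)$ entry $d(u,v)$ if $d(u,v)=\min\{e(u),e(v)\}$, and $0$ otherwise. The $\epsilon$-spectrum of $G$ is the multiset of eigenvalues of $\epsilon(G)$, and the $\epsilon$-energy $E_\epsilon(G)$ is the sum of the absolute values of these eigenvalues (with multiplicity). Two non-isomorphic graphs of the same order are $\epsilon$-cospectral if they have the same $\epsilon$-spectrum, and non $\epsilon$-cospectral otherwise. Two graphs of the same order are $\epsilon$-equienergetic if they have the same $\epsilon$-energy. *)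

theory Defs
  imports
    "HOL-Library.Multiset"
    "HOL-Computational_Algebra.Polynomial"
    "Jordan_Normal_Form.Char_Poly"
    "Graph_Theory.Digraph_Component"
    "Graph_Theory.Digraph_Isomorphism"
begin

text \<open>
  A finite simple undirected graph is a \<open>pair_graph\<close>: a finite loop-free digraph whose arc set is
  a symmetric set of pairs of vertices. The library's notion of connectedness, which requires a
  vertex to exist, is written with its full name because \<open>connected\<close> is also a topological notion.
\<close>
definition connected_graph :: "'a pair_pre_digraph \<Rightarrow> bool" where
  "connected_graph G \<longleftrightarrow> pair_graph G \<and> Digraph_Component.connected (with_proj G)"

definition order_of :: "'a pair_pre_digraph \<Rightarrow> nat" where
  "order_of G = card (pverts G)"

text \<open>Only meaningful when \<open>v\<close> is reachable from \<open>u\<close>.\<close>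
definition graph_dist :: "'a pair_pre_digraph \<Rightarrow> 'a \<Rightarrow> 'a \<Rightarrow> nat" where
  "graph_dist G u v = (LEAST k. \<exists>p. pre_digraph.awalk (with_proj G) u p v \<and> length p = k)"

definition eccentricity :: "'a pair_pre_digraph \<Rightarrow> 'a \<Rightarrow> nat" where
  "eccentricity G v = Max {graph_dist G v u | u. u \<in> pverts G}"

definition ecc_entry :: "'a pair_pre_digraph \<Rightarrow> 'a \<Rightarrow> 'a \<Rightarrow> real" where
  "ecc_entry G u v =
    (if graph_dist G u v = min (eccentricity G u) (eccentricity G v)
     then real (graph_dist G u v) else 0)"

text \<open>
  Matrices have rows and columns numbered from 0, so the vertices are listed in increasing order;
  another listing would conjugate the matrix by a permutation matrix.
\<close>
definition ecc_mat :: "'a::linorder pair_pre_digraph \<Rightarrow> real mat" where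
  "ecc_mat G =
    (let vs = sorted_list_of_set (pverts G)
     in mat (order_of G) (order_of G) (\<lambda>(i, j). ecc_entry G (vs ! i) (vs ! j)))"

text \<open>
  Eigenvalues are counted with their multiplicity as complex roots of the characteristic
  polynomial, so that no eigenvalue can be missed by definition; since the matrix is real
  symmetric, they are in fact all real.
\<close>
definition ecc_spectrum :: "'a::linorder pair_pre_digraph \<Rightarrow> complex multiset" where
  "ecc_spectrum G = proots (char_poly (map_mat complex_of_real (ecc_mat G)))"

definition ecc_energy :: "'a::linorder pair_pre_digraph \<Rightarrow> real" where
  "ecc_energy G = (\<Sum>x\<in>#ecc_spectrum G. cmod x)"

text \<open>
  Cospectrality and its negation are both notions about non-isomorphic graphs of the same order,
  so a pair of isomorphic graphs has neither property.
\<close>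
definition ecc_cospectral ::
  "'a::linorder pair_pre_digraph \<Rightarrow> 'b::linorder pair_pre_digraph \<Rightarrow> bool" where
  "ecc_cospectral G H \<longleftrightarrow>
    order_of G = order_of H \<and> \<not> digraph_iso (with_proj G) (with_proj H) \<and>
    ecc_spectrum G = ecc_spectrum H"

definition non_ecc_cospectral ::
  "'a::linorder pair_pre_digraph \<Rightarrow> 'b::linorder pair_pre_digraph \<Rightarrow> bool" where
  "non_ecc_cospectral G H \<longleftrightarrow>
    order_of G = order_of H \<and> \<not> digraph_iso (with_proj G) (with_proj H) \<and>
    \<not> ecc_cospectral G H"

definition ecc_equienergetic ::
  "'a::linorder pair_pre_digraph \<Rightarrow> 'b::linorder pair_pre_digraph \<Rightarrow> bool" where
  "ecc_equienergetic G H \<longleftrightarrow> order_of G = order_of H \<and> ecc_energy G = ecc_energy H"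

end

theory Submission
  imports Defs
begin

text \<open>
  If every vertex of \<open>G\<close> has eccentricity 2, then \<open>\<epsilon>(G)\<close> is twice the adjacency matrix of the
  complement of \<open>G\<close>. This applies when the complement is a disjoint union of at least two copies of a
  graph without isolated vertices. Now \<open>2 K\<^sub>2\<close> (adjacency eigenvalues \<open>1, 1, -1, -1\<close>) and
  \<open>K\<^sub>2\<^sub>,\<^sub>2\<close> (adjacency eigenvalues \<open>2, 0, 0, -2\<close>) both have four vertices and energy 4, so the
  complements of \<open>6t\<close> copies of \<open>K\<^sub>2\<close> and of \<open>3t\<close> copies of \<open>K\<^sub>2\<^sub>,\<^sub>2\<close> form the required pair.
\<close>

section \<open>Characteristic polynomials of block diagonal matrices\<close>

lemma char_poly_four_block_mat_diag:
  fixes A B :: "'a :: idom mat"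
  assumes A: "A \<in> carrier_mat n n" and B: "B \<in> carrier_mat m m"
  shows "char_poly (four_block_mat A (0\<^sub>m n m) (0\<^sub>m m n) B) = char_poly A * char_poly B"
proof -
  have "char_poly_matrix (four_block_mat A (0\<^sub>m n m) (0\<^sub>m m n) B) =
      four_block_mat (char_poly_matrix A) (0\<^sub>m n m) (0\<^sub>m m n) (char_poly_matrix B)"
    unfolding char_poly_matrix_def by (rule eq_matI, insert A B, auto simp: one_poly_def)
  also have "det \<dots> = det (char_poly_matrix A) * det (char_poly_matrix B)"
    by (rule det_four_block_mat_lower_left_zero) (use A B in auto)
  finally show ?thesis
    unfolding char_poly_def .
qed

lemma char_poly_diag_block_mat:
  fixes As :: "'a :: idom mat list"
  assumes "\<And>A. A \<in> set As \<Longrightarrow> square_mat A"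
  shows "char_poly (diag_block_mat As) = prod_list (map char_poly As)"
  using assms
proof (induction As)
  case Nil
  then show ?case by (simp add: char_poly_def char_poly_matrix_def)
next
  case (Cons A As)
  have A: "A \<in> carrier_mat (dim_row A) (dim_row A)"
    using Cons.prems[of A] by auto
  let ?B = "diag_block_mat As"
  have "dim_row ?B = dim_col ?B"
    unfolding dim_diag_block_mat
    using Cons.prems by (intro arg_cong[of _ _ sum_list] map_cong) auto
  then have B: "?B \<in> carrier_mat (dim_row ?B) (dim_row ?B)"
    by (intro carrier_matI) simp_all
  have IH: "char_poly ?B = prod_list (map char_poly As)"
    using Cons by simp
  have "diag_block_mat (A # As) = four_block_mat A (0\<^sub>m (dim_row A) (dim_row ?B))
      (0\<^sub>m (dim_row ?B) (dim_row A)) ?B"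
    using carrier_matD(2)[OF A] carrier_matD(2)[OF B] unfolding diag_block_mat.simps Let_def by metis
  then show ?case
    by (simp only: char_poly_four_block_mat_diag[OF A B] IH list.map prod_list.Cons)
qed

text \<open>Index \<open>i\<close> is position \<open>i mod k\<close> inside block
  \<open>i div k\<close>. This entrywise form is the one to compare with an eccentricity
  matrix.\<close>

lemma diag_block_mat_replicate:
  assumes "0 < k"
  shows "diag_block_mat (replicate m (mat k k f)) =
    mat (k * m) (k * m) (\<lambda>(i, j). if i div k = j div k then f (i mod k, j mod k) else 0)"
proof (induction m)
  case 0
  show ?case by (auto intro!: eq_matI)
next
  case (Suc m)
  \<comment> \<open>Splitting off the first block shifts the remaining indices by \<open>k\<close>,
    which lowers the block number by one and keeps the position.\<close>
  have shift: "i div k = Suc ((i - k) div k)" "i mod k = (i - k) mod k" if "k \<le> i" for i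
    using that assms by (simp_all add: le_div_geq le_mod_geq)
  show ?case
    by (rule eq_matI) (auto simp: Suc.IH Let_def shift not_less)
qed

lemma det_2:
  assumes "A \<in> carrier_mat 2 2"
  shows "det A = A $$ (0, 0) * A $$ (1, 1) - A $$ (0, 1) * A $$ (1, 0)"
proof -
  \<comment> \<open>Deleting row \<open>i\<close> and column 0 leaves a single entry, from column 1
    and the other row \<open>1 - i\<close>.\<close>
  have "det (mat_delete A i 0) = A $$ (1 - i, 1)" if "i < 2" for i
    using assms that
    by (subst det_single) (auto simp: mat_delete_def insert_index_def)
  then have "cofactor A 0 0 = A $$ (1, 1)" "cofactor A 1 0 = - A $$ (0, 1)"
    by (simp_all add: cofactor_def)
  moreover have "det A = (\<Sum>i<2. A $$ (i, 0) * cofactor A i 0)"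
    using laplace_expansion_column[OF assms, of 0] by simp
  ultimately show ?thesis
    by (simp add: numeral_2_eq_2 algebra_simps)
qed

section \<open>Distances and isomorphisms\<close>

lemma awalk_with_proj_iff:
  "pre_digraph.awalk (with_proj G) u p v \<longleftrightarrow> u \<in> pverts G \<and> set p \<subseteq> parcs G \<and> pcas u p v"
  by (simp add: pre_digraph.awalk_def cas_with_proj_eq)

lemma graph_dist_self:
  assumes "u \<in> pverts G"
  shows "graph_dist G u u = 0"
  unfolding graph_dist_def awalk_with_proj_iff
  by (rule Least_equality) (use assms in auto)

lemma graph_dist_adjacent:
  assumes "u \<in> pverts G" "(u, v) \<in> parcs G" "u \<noteq> v"
  shows "graph_dist G u v = 1"
  unfolding graph_dist_def awalk_with_proj_iff
proof (rule Least_equality)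
  show "\<exists>p. (u \<in> pverts G \<and> set p \<subseteq> parcs G \<and> pcas u p v) \<and> length p = 1"
    by (rule exI[of _ "[(u, v)]"]) (use assms in auto)
next
  fix k assume "\<exists>p. (u \<in> pverts G \<and> set p \<subseteq> parcs G \<and> pcas u p v) \<and> length p = k"
  then show "1 \<le> k"
    using assms(3) by (cases k) auto
qed

lemma graph_dist_common_neighbour:
  assumes "u \<in> pverts G" "(u, w) \<in> parcs G" "(w, v) \<in> parcs G" "(u, v) \<notin> parcs G" "u \<noteq> v"
  shows "graph_dist G u v = 2"
  unfolding graph_dist_def awalk_with_proj_iff
proof (rule Least_equality)
  show "\<exists>p. (u \<in> pverts G \<and> set p \<subseteq> parcs G \<and> pcas u p v) \<and> length p = 2"
    by (rule exI[of _ "[(u, w), (w, v)]"]) (use assms in auto)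
next
  fix k assume "\<exists>p. (u \<in> pverts G \<and> set p \<subseteq> parcs G \<and> pcas u p v) \<and> length p = k"
  then obtain p where p: "set p \<subseteq> parcs G" "pcas u p v" "length p = k"
    by auto
  have "p \<noteq> []" using p(2) assms(5) by auto
  moreover have "p \<noteq> [e]" for e using p assms(4) by (cases e) auto
  ultimately show "2 \<le> k"
    using p(3) by (cases p; cases "tl p") auto
qed

text \<open>In both graphs tail and head are \<open>fst\<close> and \<open>snd\<close>, so the
  vertex map alone determines the arc map of the isomorphism.\<close>

lemma digraph_iso_with_projE:
  assumes "digraph_iso (with_proj G) (with_proj H)"
  obtains h where "bij_betw h (pverts G) (pverts H)" "parcs H = map_prod h h ` parcs G"
proof -
  from assms obtain f where f: "pre_digraph.digraph_isomorphism (with_proj G) f"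
    and H: "with_proj H = app_iso f (with_proj G)"
    unfolding digraph_iso_def by blast
  note iso = f[unfolded pre_digraph.digraph_isomorphism_def, simplified]
  let ?h = "iso_verts f"
  have vH: "pverts H = ?h ` pverts G"
    using arg_cong[OF H, of verts] by (simp add: app_iso_def)
  have aH: "parcs H = iso_arcs f ` parcs G"
    using arg_cong[OF H, of arcs] by (simp add: app_iso_def)
  have tH: "fst = iso_tail f"
    using arg_cong[OF H, of tail] by (simp add: app_iso_def)
  have hH: "snd = iso_head f"
    using arg_cong[OF H, of head] by (simp add: app_iso_def)
  have "iso_arcs f a = map_prod ?h ?h a" if "a \<in> parcs G" for a
    using iso that by (auto simp: prod_eq_iff tH[symmetric] hH[symmetric])
  with aH have "parcs H = map_prod ?h ?h ` parcs G"
    by auto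
  then show thesis
    using that[of ?h] iso vH by (auto simp: bij_betw_def)
qed

section \<open>Complements of disjoint copies of a graph\<close>

text \<open>Vertex \<open>u\<close> stands for vertex \<open>u mod k\<close> of copy number
  \<open>u div k\<close>. Each copy occupies consecutive numbers, so the increasing vertex order
  makes the eccentricity matrix block diagonal.\<close>

definition copies_complement :: "nat \<Rightarrow> nat \<Rightarrow> (nat \<Rightarrow> nat \<Rightarrow> bool) \<Rightarrow> nat pair_pre_digraph" where
  "copies_complement k m R = \<lparr>pverts = {..<k * m},
     parcs = {(u, v). u < k * m \<and> v < k * m \<and> u \<noteq> v \<and>
       \<not> (u div k = v div k \<and> R (u mod k) (v mod k))}\<rparr>"

lemma copies_complement_simps [simp]:
  "pverts (copies_complement k m R) = {..<k * m}"
  "(u, v) \<in> parcs (copies_complement k m R) \<longleftrightarrow> u < k * m \<and> v < k * m \<and> u \<noteq> v \<and>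
     \<not> (u div k = v div k \<and> R (u mod k) (v mod k))"
  by (simp_all add: copies_complement_def)

lemma order_of_copies_complement [simp]: "order_of (copies_complement k m R) = k * m"
  by (simp add: order_of_def)

text \<open>A second copy bounds all distances in the complement by 2; the absence of isolated
  vertices makes every eccentricity reach 2.\<close>

locale base_graph =
  fixes k m :: nat and R :: "nat \<Rightarrow> nat \<Rightarrow> bool"
  assumes copies: "2 \<le> m"
    and nonempty: "0 < k"
    and sym_R: "R a b \<Longrightarrow> R b a"
    and irrefl_R: "\<not> R a a"
    and no_isolated: "a < k \<Longrightarrow> \<exists>b<k. R a b"
begin

abbreviation "CG \<equiv> copies_complement k m R"

text \<open>Every vertex of another copy is adjacent to both \<open>u\<close> and
  \<open>v\<close>.\<close>

lemma common_neighbour: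
  assumes "u < k * m" "v < k * m" "u div k = v div k"
  obtains w where "(u, w) \<in> parcs CG" "(w, v) \<in> parcs CG"
proof -
  \<comment> \<open>The first vertex of copy 1 if \<open>u\<close> lies in copy 0, and the first
    vertex of copy 0 otherwise.\<close>
  define w where "w = (if u div k = 0 then k else 0)"
  have "k * 1 < k * m"
    using copies nonempty by (intro mult_strict_left_mono) auto
  then have "w < k * m" "w div k \<noteq> u div k"
    using nonempty by (auto simp: w_def)
  then show thesis
    using assms by (intro that[of w]) auto
qed

lemma pair_graph_CG: "pair_graph CG"
proof
  show "finite (parcs CG)"
    by (rule finite_subset[of _ "{..<k * m} \<times> {..<k * m}"]) auto
  show "symmetric (with_proj CG)"
    by (auto simp: symmetric_def sym_def dest: sym_R)
qed auto

lemma connected_graph_CG: "connected_graph CG"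
proof -
  interpret pair_graph CG by (rule pair_graph_CG)
  have reach: "u \<rightarrow>\<^sup>*\<^bsub>with_proj CG\<^esub> v" if uv: "u < k * m" "v < k * m" for u v
  proof -
    consider "u = v" | "(u, v) \<in> parcs CG" | "u \<noteq> v" "(u, v) \<notin> parcs CG"
      by blast
    then show ?thesis
    proof cases
      case 1
      with uv show ?thesis by simp
    next
      case 2
      then show ?thesis by (rule reachable_adjI)
    next
      case 3
      with uv have "u div k = v div k" by simp
      with uv obtain w where "(u, w) \<in> parcs CG" "(w, v) \<in> parcs CG"
        by (rule common_neighbour)
      then show ?thesis
        by (blast intro: reachable_trans[OF reachable_adjI reachable_adjI])
    qed
  qed
  have "Digraph_Component.connected (with_proj CG)"
    unfolding Digraph_Component.connected_def
  proof (rule strongly_connectedI)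
    show "verts (with_proj (mk_symmetric (with_proj CG))) \<noteq> {}"
      using copies nonempty by (simp add: lessThan_empty_iff)
  qed (use reach reachable_mk_symmetricI in simp)
  with pair_graph_CG show ?thesis
    by (simp add: connected_graph_def)
qed

lemma graph_dist_CG:
  assumes "u < k * m" "v < k * m"
  shows "graph_dist CG u v =
    (if u = v then 0 else if u div k = v div k \<and> R (u mod k) (v mod k) then 2 else 1)"
proof (cases "u \<noteq> v \<and> u div k = v div k \<and> R (u mod k) (v mod k)")
  case True
  then obtain w where "(u, w) \<in> parcs CG" "(w, v) \<in> parcs CG"
    using common_neighbour assms by blast
  then have "graph_dist CG u v = 2"
    by (rule graph_dist_common_neighbour[rotated]) (use True assms in auto)
  then show ?thesis using True by simp
next
  case False
  then show ?thesis
    using assms graph_dist_self[of u CG] graph_dist_adjacent[of u CG v] by auto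
qed

lemma eccentricity_CG:
  assumes "u < k * m"
  shows "eccentricity CG u = 2"
proof -
  let ?D = "{graph_dist CG u v | v. v \<in> pverts CG}"
  obtain b where b: "b < k" "R (u mod k) b"
    using no_isolated[of "u mod k"] nonempty by auto
  \<comment> \<open>The vertex matching \<open>b\<close> in the copy of \<open>u\<close>: being
    related by \<open>R\<close>, it is non-adjacent to \<open>u\<close> in the complement.\<close>
  define v where "v = u div k * k + b"
  have "u div k < m"
    using assms by (simp add: less_mult_imp_div_less mult.commute)
  \<comment> \<open>The whole copy containing \<open>u\<close> ends within the vertex range, hence
    so does \<open>v\<close>.\<close>
  then have "(u div k + 1) * k \<le> m * k"
    by (intro mult_right_mono) auto
  then have v: "v < k * m" "v div k = u div k" "v mod k = b"
    using b(1) by (auto simp: v_def algebra_simps)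
  have "graph_dist CG u v = 2"
    using graph_dist_CG[OF assms v(1)] v b irrefl_R by auto
  with v(1) have "2 \<in> ?D" by force
  moreover have "?D = graph_dist CG u ` {..<k * m}" by auto
  moreover have "d \<le> 2" if "d \<in> ?D" for d
    using that assms by (auto simp: graph_dist_CG)
  ultimately show ?thesis
    unfolding eccentricity_def by (intro Max_eqI) auto
qed

text \<open>All eccentricities are 2, so exactly the pairs at distance 2 survive, and these are the
  pairs related by \<open>R\<close> within one copy.\<close>

lemma ecc_entry_CG:
  assumes "u < k * m" "v < k * m"
  shows "ecc_entry CG u v = (if u div k = v div k \<and> R (u mod k) (v mod k) then 2 else 0)"
  using assms irrefl_R by (auto simp: ecc_entry_def eccentricity_CG graph_dist_CG)

lemma ecc_mat_CG:
  "map_mat complex_of_real (ecc_mat CG) =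
    diag_block_mat (replicate m (mat k k (\<lambda>(a, b). if R a b then 2 else 0)))"
proof -
  \<comment> \<open>The listing is the identity: matrix indices and vertices coincide.\<close>
  have "sorted_list_of_set {..<k * m} = [0..<k * m]"
    by (simp add: lessThan_atLeast0)
  then show ?thesis
    unfolding diag_block_mat_replicate[OF nonempty]
    by (intro eq_matI) (auto simp: ecc_mat_def Let_def ecc_entry_CG)
qed

lemma ecc_spectrum_CG:
  "ecc_spectrum CG =
    repeat_mset m (proots (char_poly (mat k k (\<lambda>(a, b). if R a b then 2 else 0))))"
proof -
  let ?M = "mat k k (\<lambda>(a, b). if R a b then 2 else 0) :: complex mat"
  have "char_poly (diag_block_mat (replicate m ?M)) = char_poly ?M ^ m"
    by (subst char_poly_diag_block_mat) (auto simp: map_replicate prod_list_replicate)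
  then show ?thesis
    by (simp add: ecc_spectrum_def ecc_mat_CG proots_power)
qed

end

section \<open>The two graphs\<close>

lemma proots_char_poly_K2:
  "proots (char_poly (mat 2 2 (\<lambda>(a, b). if a \<noteq> b then 2 else (0 :: complex)))) = {#2, -2#}"
proof -
  have "char_poly (mat 2 2 (\<lambda>(a, b). if a \<noteq> b then 2 else (0 :: complex))) =
      [:- 2, 1:] * [:2, 1:]"
    by (simp add: char_poly_def char_poly_matrix_def det_2)
  also have "proots \<dots> = {#2, -2#}"
    by (subst proots_mult) auto
  finally show ?thesis .
qed

text \<open>The parts {0, 1} and {2, 3} split the characteristic matrix into blocks \<open>X\<close>
  (x times the identity) and \<open>J\<close> (all entries -2). These commute, so the determinant is
  that of \<open>X * X - J * J\<close>, namely (x^2 - 8)^2 - 64 = x^2 (x^2 - 16).\<close>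

lemma proots_char_poly_K22:
  "proots (char_poly (mat 4 4 (\<lambda>(a, b). if (a < 2) \<noteq> (b < 2) then 2 else (0 :: complex)))) =
    {#4, -4, 0, 0#}" (is "proots (char_poly ?M) = _")
proof -
  define X J :: "complex poly mat"
    where "X = mat 2 2 (\<lambda>(i, j). if i = j then [:0, 1:] else 0)" and "J = mat 2 2 (\<lambda>_. [:-2:])"
  have [simp]: "X \<in> carrier_mat 2 2" "J \<in> carrier_mat 2 2"
    by (simp_all add: X_def J_def)
  have comm: "J * X = X * J"
    by (rule eq_matI) (auto simp: X_def J_def scalar_prod_def numeral_2_eq_2 less_Suc_eq)
  have "char_poly_matrix ?M = four_block_mat X J J X"
    by (rule eq_matI) (auto simp: char_poly_matrix_def X_def J_def)
  then have "char_poly ?M = det (X * X - J * J)"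
    unfolding char_poly_def by (simp add: det_four_block_mat[of X 2, OF _ _ _ _ comm])
  also have "\<dots> = [:- 4, 1:] * [:4, 1:] * [:0, 1:] * [:0, 1:]"
    by (subst det_2) (auto simp: X_def J_def scalar_prod_def numeral_2_eq_2 numeral_poly)
  also have "proots \<dots> = {#4, -4, 0, 0#}"
    by (simp add: proots_mult del: mult_pCons_left mult_pCons_right)
  finally show ?thesis .
qed

theorem theorem5p1:
  fixes t :: nat
  assumes "t \<ge> 3"
  shows "\<exists>(G :: nat pair_pre_digraph) (H :: nat pair_pre_digraph).
    connected_graph G \<and> connected_graph H \<and>
    order_of G = 12 * t \<and> order_of H = 12 * t \<and>
    non_ecc_cospectral G H \<and> ecc_equienergetic G H"
proof -
  interpret K2: base_graph 2 "6 * t" "(\<noteq>)"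
  proof
    show "\<exists>b<2. a \<noteq> b" if "a < 2" for a :: nat
      by (rule exI[of _ "if a = 0 then 1 else 0"]) auto
  qed (use assms in auto)
  interpret K22: base_graph 4 "3 * t" "\<lambda>a b. (a < 2) \<noteq> (b < 2)"
  proof
    show "\<exists>b<4. (a < 2) \<noteq> (b < (2 :: nat))" if "a < 4" for a :: nat
      by (rule exI[of _ "if a < 2 then 2 else 0"]) auto
  qed (use assms in auto)
  have spec2: "ecc_spectrum K2.CG = repeat_mset (6 * t) {#2, -2#}"
    unfolding K2.ecc_spectrum_CG proots_char_poly_K2 ..
  have spec22: "ecc_spectrum K22.CG = repeat_mset (3 * t) {#4, -4, 0, 0#}"
    unfolding K22.ecc_spectrum_CG proots_char_poly_K22 ..
  have energy_repeat: "(\<Sum>x\<in>#repeat_mset n A. cmod x) = n * (\<Sum>x\<in>#A. cmod x)" for n A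
    by (induction n) (simp_all add: distrib_right sum_mset.distrib)
  \<comment> \<open>Both energies equal 24t, as 6t * (2 + 2) and as 3t * (4 + 4).\<close>
  have "ecc_energy K2.CG = ecc_energy K22.CG"
    unfolding ecc_energy_def spec2 spec22 energy_repeat by simp
  \<comment> \<open>The eigenvalue 2 has multiplicity 6t in the first spectrum and does not occur in
    the second.\<close>
  moreover have "count (ecc_spectrum K2.CG) 2 \<noteq> count (ecc_spectrum K22.CG) 2"
    unfolding spec2 spec22 using assms by simp
  then have "\<not> ecc_cospectral K2.CG K22.CG"
    unfolding ecc_cospectral_def by metis
  \<comment> \<open>Every vertex of the first graph is non-adjacent to one other vertex, and of the second to two.\<close>
  moreover have "\<not> digraph_iso (with_proj K2.CG) (with_proj K22.CG)"
  proof
    assume "digraph_iso (with_proj K2.CG) (with_proj K22.CG)"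
    then obtain h where h: "bij_betw h (pverts K2.CG) (pverts K22.CG)"
      and arcs: "parcs K22.CG = map_prod h h ` parcs K2.CG"
      by (rule digraph_iso_with_projE)
    have "h ` pverts K2.CG = {..<4 * (3 * t)}"
      using h by (simp add: bij_betw_def)
    \<comment> \<open>Vertex 0 of the second graph is non-adjacent to both 2 and 3, the opposite
      part of its copy of \<open>K\<^sub>2\<^sub>,\<^sub>2\<close>.\<close>
    then have "0 \<in> h ` pverts K2.CG" "2 \<in> h ` pverts K2.CG" "3 \<in> h ` pverts K2.CG"
      using assms by simp_all
    then obtain u v w where uvw: "u \<in> pverts K2.CG" "v \<in> pverts K2.CG" "w \<in> pverts K2.CG"
      and img: "h u = 0" "h v = 2" "h w = 3"
      by (elim imageE) metis
    \<comment> \<open>Non-adjacency pulls back along \<open>h\<close>, and in the first graph it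
      means being the two ends of one copy of \<open>K\<^sub>2\<close>.\<close>
    have same_pair: "x div 2 = y div 2 \<and> x mod 2 \<noteq> y mod 2"
      if "x \<in> pverts K2.CG" "y \<in> pverts K2.CG" "x \<noteq> y" "(h x, h y) \<notin> parcs K22.CG" for x y
    proof -
      have "(x, y) \<notin> parcs K2.CG"
      proof
        assume "(x, y) \<in> parcs K2.CG"
        from imageI[OF this, of "map_prod h h"] have "(h x, h y) \<in> parcs K22.CG"
          by (simp only: arcs map_prod_simp)
        with that(4) show False ..
      qed
      with that(1-3) show ?thesis
        unfolding copies_complement_simps by blast
    qed
    have "u div 2 = v div 2 \<and> u mod 2 \<noteq> v mod 2"
      using uvw img by (intro same_pair) auto
    moreover have "u div 2 = w div 2 \<and> u mod 2 \<noteq> w mod 2"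
      using uvw img by (intro same_pair) auto
    \<comment> \<open>There are only two residues modulo 2, so \<open>v\<close> and
      \<open>w\<close>, both differing from \<open>u\<close>, share theirs.\<close>
    ultimately have "v div 2 = w div 2" "v mod 2 = w mod 2"
      by (auto simp: mod2_eq_if split: if_splits)
    then have "v = w"
      by (metis div_mult_mod_eq)
    with img show False
      by simp
  qed
  ultimately show ?thesis
    using K2.connected_graph_CG K22.connected_graph_CG
    by (intro exI[of _ K2.CG] exI[of _ K22.CG])
      (simp add: non_ecc_cospectral_def ecc_equienergetic_def)
qed

end
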